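(* The two-sided left overlap division $\mathcal W$ is a weak involutive division; that is, it does not satisfy all the conditions defining a strong involutive division.
   Context: Monomials are words in the noncommuting variables $x_1,\dots,x_n$ of a noncommutative polynomial ring (the division $\mathcal W$ is defined for every such ring; failure of strongness in some such ring, e.g. with three variables, is what is meant). An involutive division is a rule $I$ assigning to every finite set $U$ of monomials and every $u\in U$ a set $\mathcal M^L_I(u,U)\subseteq\{x_1,\dots,x_n\}$ of left multiplicative variables and a set $\mathcal M^R_I(u,U)\subseteq\{x_1,\dots,x_n\}$ of right multiplicative variables. For $u\in U$ and a factorisation $w=v_1uv_2$, $u$ is an involutive divisor of $w$ at this factorisation if (thin divisors) the last letter of $v_1$ (if $v_1\ne1$) is in $\mathcal M^L_I(u,U)$ and the first letter of $v_2$ (if $v_2\neq1$) is in $\mathcal M^R_I(u,U)$. Write $u\mid_I w$ if this holds for some factorisation, and let $\mathcal C_I(u,U)=\{w : u\mid_I w\}$. $I$ is strong if for every finite $U$: (Disjoint Cones) if $\mathcal C_I(u_1,U)\cap\mathcal C_I(u_2,U)\ne\emptyset$ for $u_1,u_2\in U$, then one of these cones is contained in the other; (Unique Divisor) each $w\in\mathcal C_I(u,U)$ is involutively divisible by $u$ at exactly one factorisation; (Subset) if $V\subset U$ then $\mathcal M^L_I(v,U)\subseteq\mathcal M^L_I(v,V)$ and $\mathcal M^R_I(v,U)\subseteq\mathcal M^R_I(v,V)$ for all $v\in V$. If any of these conditions is not satisfied, $I$ is weak. DegRevLex ordering (with $x_1>x_2>\cdots>x_n$): $m_1<m_2$ if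 $\deg m_1<\deg m_2$, or the degrees are equal and, reading from right to left, at the first position where the words differ the letter of $m_1$ is greater than that of $m_2$. Two-sided left overlap division $\mathcal W$. Let $U=\{u_1,\dots,u_m\}$ be a finite set of monomials listed so that $u_1>u_2>\cdots>u_m$ in DegRevLex. Start with all variables left and right multiplicative for all $u_i$. For $i=1,\dots,m$ and, for each $i$, for $j=i,i+1,\dots,m$, with $u_i=x_{i_1}\cdots x_{i_\alpha}$ and $u_j=x_{j_1}\cdots x_{j_\beta}$, do: (1) if $i\ne j$, then for each $1\le k\le\alpha-\beta+1$ with $x_{i_k}\cdots x_{i_{k+\beta-1}}=u_j$: if $k<\alpha-\beta+1$ make $x_{i_{k+\beta}}$ right nonmultiplicative for $u_j$, and if $k=\alpha-\beta+1$ make $x_{i_{k-1}}$ left nonmultiplicative for $u_j$; (2) for $k=1,\dots,\beta-1$ in order: if the prefix of $u_i$ of length $k$ equals the suffix of $u_j$ of length $k$, and currently $x_{j_{\beta-k}}$ is left multiplicative for $u_i$ and $x_{i_{k+1}}$ is right multiplicative for $u_j$, make $x_{i_{k+1}}$ right nonmultiplicative for $u_j$; then, if the suffix of $u_i$ of length $k$ equals the prefix of $u_j$ of length $k$, and currently $x_{j_{k+1}}$ is right multiplicative for $u_i$ and $x_{i_{\alpha-k}}$ is left multiplicative for $u_j$, make $x_{i_{\alpha-k}}$ left nonmultiplicative for $u_j$. *)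

theory Defs
  imports Main
begin

section \<open>Monomials and the DegRevLex ordering\<close>

text \<open>The variables \<open>x\<^sub>1, \<dots>, x\<^sub>n\<close> are represented by their indices and monomials by lists
  of indices; the empty list is the unit monomial.\<close>

type_synonym monomial = "nat list"

definition monomials :: "nat \<Rightarrow> monomial set" where
  "monomials n = lists {1..n}"

text \<open>As \<open>x\<^sub>1 > \<dots> > x\<^sub>n\<close>, the greater of two letters is the one with the smaller index; hence the
  comparison \<open>u ! i < v ! i\<close> of indices in the definition of \<open>u < v\<close>.\<close>

definition degrevlex_less :: "monomial \<Rightarrow> monomial \<Rightarrow> bool" where
  "degrevlex_less u v \<longleftrightarrow>
     length u < length v \<or>
     length u = length v \<and>
       (\<exists>i<length u. u ! i < v ! i \<and> (\<forall>j. i < j \<and> j < length u \<longrightarrow> u ! j = v ! j))"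

definition decreasing_list :: "monomial set \<Rightarrow> monomial list" where
  "decreasing_list U = (THE us. set us = U \<and> sorted_wrt (\<lambda>u v. degrevlex_less v u) us)"

lemma degrevlex_less_irrefl: "\<not> degrevlex_less u u"
  by (auto simp: degrevlex_less_def)

lemma degrevlex_less_trans:
  assumes "degrevlex_less u v" "degrevlex_less v w"
  shows "degrevlex_less u w"
proof (cases "length u = length v \<and> length v = length w")
  case True
  with assms obtain i j where
    i: "i < length u" "u ! i < v ! i" "\<forall>k. i < k \<and> k < length u \<longrightarrow> u ! k = v ! k" and
    j: "j < length u" "v ! j < w ! j" "\<forall>k. j < k \<and> k < length u \<longrightarrow> v ! k = w ! k"
    by (auto simp: degrevlex_less_def)
  have "max i j < length u" "u ! max i j < w ! max i j"
    "\<forall>k. max i j < k \<and> k < length u \<longrightarrow> u ! k = w ! k"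
    using i j by (cases i j rule: linorder_cases; force simp: max_def)+
  with True show ?thesis
    unfolding degrevlex_less_def by (metis (no_types, lifting))
qed (use assms in \<open>auto simp: degrevlex_less_def\<close>)

lemma degrevlex_less_total: "u = v \<or> degrevlex_less u v \<or> degrevlex_less v u"
proof (cases "length u = length v \<and> u \<noteq> v")
  case True
  define D where "D = {i. i < length u \<and> u ! i \<noteq> v ! i}"
  have D: "finite D" "D \<noteq> {}"
    using True by (auto simp: D_def list_eq_iff_nth_eq)
  have "Max D < length u" "u ! Max D \<noteq> v ! Max D"
    using Max_in[OF D] by (auto simp: D_def)
  moreover have "u ! j = v ! j" if "Max D < j" "j < length u" for j
  proof (rule ccontr)
    assume "u ! j \<noteq> v ! j"
    then have "j \<in> D"
      using that by (simp add: D_def)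
    then show False
      using Max_ge[OF D(1)] that by (simp add: leD)
  qed
  ultimately show ?thesis
    using True unfolding degrevlex_less_def by (metis nat_neq_iff)
qed (auto simp: degrevlex_less_def)

lemma decreasing_list_ex1:
  assumes "finite U"
  shows "\<exists>!us. set us = U \<and> sorted_wrt (\<lambda>u v. degrevlex_less v u) us"
proof -
  interpret linorder "\<lambda>u v. u = v \<or> degrevlex_less v u" "\<lambda>u v. degrevlex_less v u"
    by unfold_locales
      (use degrevlex_less_irrefl degrevlex_less_trans degrevlex_less_total in blast)+
  show ?thesis
    using finite_sorted_distinct_unique[OF assms] by (simp add: strict_sorted_iff)
qed


section \<open>Involutive divisions\<close>

record involutive_rule =
  left_mult :: "monomial \<Rightarrow> monomial set \<Rightarrow> nat set"
  right_mult :: "monomial \<Rightarrow> monomial set \<Rightarrow> nat set"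

definition involutive_division :: "nat \<Rightarrow> involutive_rule \<Rightarrow> bool" where
  "involutive_division n I \<longleftrightarrow>
     (\<forall>U u. finite U \<and> U \<subseteq> monomials n \<and> u \<in> U \<longrightarrow>
        left_mult I u U \<subseteq> {1..n} \<and> right_mult I u U \<subseteq> {1..n})"

definition inv_divides_at ::
  "involutive_rule \<Rightarrow> monomial set \<Rightarrow> monomial \<Rightarrow> monomial \<Rightarrow> monomial \<Rightarrow> monomial \<Rightarrow> bool" where
  "inv_divides_at I U u w v1 v2 \<longleftrightarrow>
     w = v1 @ u @ v2 \<and>
     (v1 \<noteq> [] \<longrightarrow> last v1 \<in> left_mult I u U) \<and>
     (v2 \<noteq> [] \<longrightarrow> hd v2 \<in> right_mult I u U)"

definition inv_cone ::
  "nat \<Rightarrow> involutive_rule \<Rightarrow> monomial set \<Rightarrow> monomial \<Rightarrow> monomial set" where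
  "inv_cone n I U u = {w \<in> monomials n. \<exists>v1 v2. inv_divides_at I U u w v1 v2}"

definition disjoint_cones :: "nat \<Rightarrow> involutive_rule \<Rightarrow> monomial set \<Rightarrow> bool" where
  "disjoint_cones n I U \<longleftrightarrow>
     (\<forall>u1\<in>U. \<forall>u2\<in>U. inv_cone n I U u1 \<inter> inv_cone n I U u2 \<noteq> {} \<longrightarrow>
        inv_cone n I U u1 \<subseteq> inv_cone n I U u2 \<or> inv_cone n I U u2 \<subseteq> inv_cone n I U u1)"

definition unique_divisor :: "nat \<Rightarrow> involutive_rule \<Rightarrow> monomial set \<Rightarrow> bool" where
  "unique_divisor n I U \<longleftrightarrow>
     (\<forall>u\<in>U. \<forall>w\<in>inv_cone n I U u. \<exists>!p. inv_divides_at I U u w (fst p) (snd p))"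

definition subset_condition :: "involutive_rule \<Rightarrow> monomial set \<Rightarrow> bool" where
  "subset_condition I U \<longleftrightarrow>
     (\<forall>V v. V \<subseteq> U \<and> v \<in> V \<longrightarrow>
        left_mult I v U \<subseteq> left_mult I v V \<and> right_mult I v U \<subseteq> right_mult I v V)"

definition strong_conditions :: "nat \<Rightarrow> involutive_rule \<Rightarrow> bool" where
  "strong_conditions n I \<longleftrightarrow>
     (\<forall>U. finite U \<and> U \<subseteq> monomials n \<longrightarrow>
        disjoint_cones n I U \<and> unique_divisor n I U \<and> subset_condition I U)"

definition weak_involutive_division :: "nat \<Rightarrow> involutive_rule \<Rightarrow> bool" where
  "weak_involutive_division n I \<longleftrightarrow> involutive_division n I \<and> \<not> strong_conditions n I"


section \<open>The two-sided left overlap division\<close>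

text \<open>The state of the algorithm consists of the variables that are currently left and right
  multiplicative for each monomial.\<close>

type_synonym mult_state = "(monomial \<Rightarrow> nat set) \<times> (monomial \<Rightarrow> nat set)"

fun make_left_nonmult :: "monomial \<Rightarrow> nat \<Rightarrow> mult_state \<Rightarrow> mult_state" where
  "make_left_nonmult u x (L, R) = (L(u := L u - {x}), R)"

fun make_right_nonmult :: "monomial \<Rightarrow> nat \<Rightarrow> mult_state \<Rightarrow> mult_state" where
  "make_right_nonmult u x (L, R) = (L, R(u := R u - {x}))"

text \<open>Positions in words are counted from 1.\<close>

definition letter :: "monomial \<Rightarrow> nat \<Rightarrow> nat" where
  "letter u k = u ! (k - 1)"

definition prefix_of_len :: "nat \<Rightarrow> monomial \<Rightarrow> monomial" where
  "prefix_of_len k u = take k u"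

definition suffix_of_len :: "nat \<Rightarrow> monomial \<Rightarrow> monomial" where
  "suffix_of_len k u = drop (length u - k) u"

definition subword :: "monomial \<Rightarrow> nat \<Rightarrow> nat \<Rightarrow> monomial" where
  "subword u k l = take l (drop (k - 1) u)"

definition subword_step :: "monomial \<Rightarrow> monomial \<Rightarrow> nat \<Rightarrow> mult_state \<Rightarrow> mult_state" where
  "subword_step u v k s =
     (if subword u k (length v) = v
      then if k < length u + 1 - length v
           then make_right_nonmult v (letter u (k + length v)) s
           else make_left_nonmult v (letter u (k - 1)) s
      else s)"

fun prefix_step :: "monomial \<Rightarrow> monomial \<Rightarrow> nat \<Rightarrow> mult_state \<Rightarrow> mult_state" where
  "prefix_step u v k (L, R) =
     (if prefix_of_len k u = suffix_of_len k v \<and>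
         letter v (length v - k) \<in> L u \<and> letter u (k + 1) \<in> R v
      then make_right_nonmult v (letter u (k + 1)) (L, R)
      else (L, R))"

fun suffix_step :: "monomial \<Rightarrow> monomial \<Rightarrow> nat \<Rightarrow> mult_state \<Rightarrow> mult_state" where
  "suffix_step u v k (L, R) =
     (if suffix_of_len k u = prefix_of_len k v \<and>
         letter v (k + 1) \<in> R u \<and> letter u (length u - k) \<in> L v
      then make_left_nonmult v (letter u (length u - k)) (L, R)
      else (L, R))"

text \<open>In the first interval below, \<open>k\<close> ranges over \<open>1 \<le> k \<le> length u - length v + 1\<close>; in the
  second one over \<open>1 \<le> k \<le> length v - 1\<close>.  The words are pairwise distinct, so \<open>u \<noteq> v\<close> says
  that their positions in the list differ.\<close>

definition pair_step :: "monomial \<Rightarrow> monomial \<Rightarrow> mult_state \<Rightarrow> mult_state" where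
  "pair_step u v s =
     fold (\<lambda>k t. suffix_step u v k (prefix_step u v k t)) [1..<length v]
       (if u \<noteq> v then fold (subword_step u v) [1..<length u + 2 - length v] s else s)"

definition left_overlap_run :: "nat \<Rightarrow> monomial list \<Rightarrow> mult_state" where
  "left_overlap_run n us =
     fold (\<lambda>i. fold (\<lambda>j. pair_step (us ! i) (us ! j)) [i..<length us]) [0..<length us]
       (\<lambda>_. {1..n}, \<lambda>_. {1..n})"

definition left_overlap_division :: "nat \<Rightarrow> involutive_rule" where
  "left_overlap_division n =
     \<lparr>left_mult = (\<lambda>u U. fst (left_overlap_run n (decreasing_list U)) u),
      right_mult = (\<lambda>u U. snd (left_overlap_run n (decreasing_list U)) u)\<rparr>"

end

(* The division W only compares proper overlaps of words, and a single letter x has none.  For the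
   set {x}, all variables therefore stay multiplicative for x, so x divides x x involutively at both
   factorisations, which violates the Unique Divisor condition. *)
theory Submission
  imports Defs
begin

lemma fold_invariant_closed:
  assumes "\<And>x s. P s \<Longrightarrow> P (f x s)" "P s"
  shows "P (fold f xs s)"
  using assms(2) by (induction xs arbitrary: s) (auto intro: assms(1))

text \<open>Invariant of the algorithm: each step only removes variables, so a bound
  \<open>A\<close> on the initial sets persists. With \<open>A = {1..n}\<close> it gives the typing
  condition in \<open>involutive_division\<close>.\<close>

definition mult_bounded :: "nat set \<Rightarrow> mult_state \<Rightarrow> bool" where
  "mult_bounded A s \<longleftrightarrow> (\<forall>u. fst s u \<subseteq> A \<and> snd s u \<subseteq> A)"

lemma mult_bounded_make_left_nonmult:
  "mult_bounded A s \<Longrightarrow> mult_bounded A (make_left_nonmult u x s)"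
  by (cases s) (auto simp: mult_bounded_def)

lemma mult_bounded_make_right_nonmult:
  "mult_bounded A s \<Longrightarrow> mult_bounded A (make_right_nonmult u x s)"
  by (cases s) (auto simp: mult_bounded_def)

lemmas mult_bounded_make_nonmult =
  mult_bounded_make_left_nonmult mult_bounded_make_right_nonmult

lemma mult_bounded_subword_step: "mult_bounded A s \<Longrightarrow> mult_bounded A (subword_step u v k s)"
  by (simp add: subword_step_def mult_bounded_make_nonmult)

lemma mult_bounded_prefix_step: "mult_bounded A s \<Longrightarrow> mult_bounded A (prefix_step u v k s)"
  by (cases s) (simp add: mult_bounded_make_nonmult del: make_right_nonmult.simps)

lemma mult_bounded_suffix_step: "mult_bounded A s \<Longrightarrow> mult_bounded A (suffix_step u v k s)"
  by (cases s) (simp add: mult_bounded_make_nonmult del: make_left_nonmult.simps)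

lemma mult_bounded_pair_step: "mult_bounded A s \<Longrightarrow> mult_bounded A (pair_step u v s)"
  unfolding pair_step_def
  by (auto intro!: fold_invariant_closed[where P = "mult_bounded A"]
      mult_bounded_subword_step mult_bounded_prefix_step mult_bounded_suffix_step)

lemma mult_bounded_left_overlap_run: "mult_bounded {1..n} (left_overlap_run n us)"
  unfolding left_overlap_run_def
  by (intro fold_invariant_closed[where P = "mult_bounded {1..n}"] mult_bounded_pair_step)
    (simp_all add: mult_bounded_def)

lemma involutive_division_left_overlap: "involutive_division n (left_overlap_division n)"
  using mult_bounded_left_overlap_run
  by (simp add: involutive_division_def left_overlap_division_def mult_bounded_def)

lemma decreasing_list_singleton: "decreasing_list {u} = [u]"
  unfolding decreasing_list_def by (rule the1_equality[OF decreasing_list_ex1]) simp_all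

text \<open>The only pair treated is \<open>[x]\<close> with itself: the subword steps are skipped
  since the words coincide, and the overlap lengths range over the empty list
  \<open>[1..<1]\<close>. Hence the initial state survives.\<close>

lemma left_overlap_run_letter: "left_overlap_run n [[x]] = (\<lambda>_. {1..n}, \<lambda>_. {1..n})"
  by (simp add: left_overlap_run_def pair_step_def)

lemma inv_divides_at_letter:
  "inv_divides_at (left_overlap_division n) {[x]} [x] w v1 v2 \<longleftrightarrow>
     w = v1 @ [x] @ v2 \<and> (v1 \<noteq> [] \<longrightarrow> last v1 \<in> {1..n}) \<and> (v2 \<noteq> [] \<longrightarrow> hd v2 \<in> {1..n})"
  by (simp add: inv_divides_at_def left_overlap_division_def decreasing_list_singleton
      left_overlap_run_letter)

lemma not_unique_divisor_letter:
  assumes "x \<in> {1..n}"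
  shows "\<not> unique_divisor n (left_overlap_division n) {[x]}"
proof
  let ?div = "\<lambda>p. inv_divides_at (left_overlap_division n) {[x]} [x] [x, x] (fst p) (snd p)"
  assume unique: "unique_divisor n (left_overlap_division n) {[x]}"
  \<comment> \<open>The divisor is the first letter of \<open>[x, x]\<close> in one factorisation
    and the last in the other; the remaining letter is again \<open>x\<close>, multiplicative on
    either side.\<close>
  have left: "?div ([], [x])" and right: "?div ([x], [])"
    using assms by (simp_all add: inv_divides_at_letter)
  have "[x, x] \<in> inv_cone n (left_overlap_division n) {[x]} [x]"
    using assms left by (auto simp: inv_cone_def monomials_def)
  then have "\<exists>!p. ?div p"
    using unique by (simp add: unique_divisor_def)
  then show False
    using left right by blast
qed

text \<open>One variable suffices. For \<open>n = 0\<close> the empty word is the only monomial, and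
  it has a single factorisation.\<close>

lemma weak_left_overlap_division:
  assumes "n \<ge> 1"
  shows "weak_involutive_division n (left_overlap_division n)"
proof -
  have "finite {[1::nat]}" "{[1]} \<subseteq> monomials n"
    using assms by (auto simp: monomials_def)
  then have "\<not> strong_conditions n (left_overlap_division n)"
    using not_unique_divisor_letter[of 1 n] assms unfolding strong_conditions_def by auto
  then show ?thesis
    by (simp add: weak_involutive_division_def involutive_division_left_overlap)
qed

text \<open>The rule must be a division in every ring, whereas weakness asks for a violated
  condition in some ring only; hence the two quantifiers.\<close>

theorem proposition5p5p30:
  shows "(\<forall>n. involutive_division n (left_overlap_division n)) \<and>
    (\<exists>n. weak_involutive_division n (left_overlap_division n))"
  using involutive_division_left_overlap weak_left_overlap_division by blast

end
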